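(* Let $\mathscr{S}$ be a collection of spectral functions. Then the pair $(L_{\mathscr{S}},\|\cdot\|_{\mathscr{S}})$ is a Banach space.
   Context: Let $(\Omega,\mathcal{F},P)$ be a probability space; real-valued random variables are identified when almost surely equal and $L^1=L^1(\Omega,\mathcal{F},P)$. A spectral function is a nondecreasing function $\sigma:[0,1)\to[0,\infty)$ with $\int_0^1\sigma(u)\,du=1$; $\mathscr{S}$ is nonempty. For a random variable $Y$ and $0<u<1$ let $F_Y^{-1}(u):=\inf\{y:P(Y\le y)\ge u\}$, and let $\rho_\sigma(Y):=\int_0^1\sigma(u)F_Y^{-1}(u)\,du$ when the integral exists. Put $\rho_{\mathscr{S}}(Y):=\sup_{\sigma\in\mathscr{S}}\rho_\sigma(Y)$, $\|Y\|_{\mathscr{S}}:=\rho_{\mathscr{S}}(|Y|)=\sup_{\sigma\in\mathscr{S}}\rho_\sigma(|Y|)\in[0,\infty]$, and $L_{\mathscr{S}}:=\{Y\in L^1:\|Y\|_{\mathscr{S}}<\infty\}$. *)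

theory Defs
  imports "HOL-Probability.Probability" "HOL-Algebra.Module" "HOL-Algebra.Algebraic_Closure_Type"
begin

section \<open>Banach spaces on a carrier\<close>

text \<open>
  The spaces below depend on a measure and on a set of functions, so they cannot be
  instances of the type class \<open>banach\<close>.  A real vector space is a module
  over the field of reals; the ring fields \<open>mult\<close> and \<open>one\<close> of the
  module record play no role in it.  Since \<open>Metric_space\<close> wants symmetry and
  nonnegativity on the whole type, the induced metric is set to 0 off the carrier.
\<close>

definition normed_vector_space :: "(real, 'b) module \<Rightarrow> ('b \<Rightarrow> real) \<Rightarrow> bool" where
  "normed_vector_space V nrm \<longleftrightarrow>
     module (ring_of_type_algebra :: real ring) V \<and>
     (\<forall>x\<in>carrier V. 0 \<le> nrm x) \<and>
     (\<forall>x\<in>carrier V. nrm x = 0 \<longleftrightarrow> x = \<zero>\<^bsub>V\<^esub>) \<and>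
     (\<forall>a. \<forall>x\<in>carrier V. nrm (a \<odot>\<^bsub>V\<^esub> x) = \<bar>a\<bar> * nrm x) \<and>
     (\<forall>x\<in>carrier V. \<forall>y\<in>carrier V. nrm (x \<oplus>\<^bsub>V\<^esub> y) \<le> nrm x + nrm y)"

definition norm_metric :: "(real, 'b) module \<Rightarrow> ('b \<Rightarrow> real) \<Rightarrow> 'b \<Rightarrow> 'b \<Rightarrow> real" where
  "norm_metric V nrm x y =
     (if x \<in> carrier V \<and> y \<in> carrier V then nrm (x \<ominus>\<^bsub>V\<^esub> y) else 0)"

definition banach_space :: "(real, 'b) module \<Rightarrow> ('b \<Rightarrow> real) \<Rightarrow> bool" where
  "banach_space V nrm \<longleftrightarrow>
     normed_vector_space V nrm \<and>
     Metric_space (carrier V) (norm_metric V nrm) \<and>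
     Metric_space.mcomplete (carrier V) (norm_metric V nrm)"

section \<open>Spectral functions and spectral risk measures\<close>

text \<open>Only the values on \<open>[0,1)\<close> are relevant.\<close>

definition spectral_function :: "(real \<Rightarrow> real) \<Rightarrow> bool" where
  "spectral_function \<sigma> \<longleftrightarrow>
     mono_on {0..<1} \<sigma> \<and> (\<forall>u\<in>{0..<1}. 0 \<le> \<sigma> u) \<and>
     set_integrable lborel {0..<1} \<sigma> \<and> (LBINT u:{0..<1}. \<sigma> u) = 1"

definition quantile :: "'a measure \<Rightarrow> ('a \<Rightarrow> real) \<Rightarrow> real \<Rightarrow> real" where
  "quantile M Y u = Inf {y. \<P>(\<omega> in M. Y \<omega> \<le> y) \<ge> u}"

text \<open>
  The extended Lebesgue integral as the difference of the integrals of the positive and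
  negative parts (\<open>ennreal\<close> maps negative reals to 0).  It does not exist when both
  are infinite, and the value is then meaningless; for nonnegative random variables
  this cannot happen, because the negative part vanishes.
\<close>

definition spectral_risk :: "'a measure \<Rightarrow> (real \<Rightarrow> real) \<Rightarrow> ('a \<Rightarrow> real) \<Rightarrow> ereal" where
  "spectral_risk M \<sigma> Y =
     enn2ereal (\<integral>\<^sup>+u\<in>{0<..<1}. ennreal (\<sigma> u * quantile M Y u) \<partial>lborel) -
     enn2ereal (\<integral>\<^sup>+u\<in>{0<..<1}. ennreal (- (\<sigma> u * quantile M Y u)) \<partial>lborel)"

definition sup_spectral_risk ::
    "'a measure \<Rightarrow> (real \<Rightarrow> real) set \<Rightarrow> ('a \<Rightarrow> real) \<Rightarrow> ereal" where
  "sup_spectral_risk M S Y = (SUP \<sigma>\<in>S. spectral_risk M \<sigma> Y)"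

section \<open>Random variables up to almost sure equality\<close>

definition as_eq :: "'a measure \<Rightarrow> (('a \<Rightarrow> real) \<times> ('a \<Rightarrow> real)) set" where
  "as_eq M = {(Y, Z). Y \<in> borel_measurable M \<and> Z \<in> borel_measurable M \<and>
                      (AE \<omega> in M. Y \<omega> = Z \<omega>)}"

definition L1_classes :: "'a measure \<Rightarrow> ('a \<Rightarrow> real) set set" where
  "L1_classes M = {Y. integrable M Y} // as_eq M"

text \<open>
  Operations on classes via representatives; \<open>the_elem\<close> and the unions are over
  singletons by the lemmas at the end.
\<close>

definition class_add ::
    "'a measure \<Rightarrow> ('a \<Rightarrow> real) set \<Rightarrow> ('a \<Rightarrow> real) set \<Rightarrow> ('a \<Rightarrow> real) set" where
  "class_add M A B = (\<Union>Y\<in>A. \<Union>Z\<in>B. as_eq M `` {\<lambda>\<omega>. Y \<omega> + Z \<omega>})"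

definition class_scale :: "'a measure \<Rightarrow> real \<Rightarrow> ('a \<Rightarrow> real) set \<Rightarrow> ('a \<Rightarrow> real) set" where
  "class_scale M c A = (\<Union>Y\<in>A. as_eq M `` {\<lambda>\<omega>. c * Y \<omega>})"

definition spectral_norm ::
    "'a measure \<Rightarrow> (real \<Rightarrow> real) set \<Rightarrow> ('a \<Rightarrow> real) set \<Rightarrow> ereal" where
  "spectral_norm M S A = the_elem ((\<lambda>Z. sup_spectral_risk M S (\<lambda>\<omega>. \<bar>Z \<omega>\<bar>)) ` A)"

definition L_spectral ::
    "'a measure \<Rightarrow> (real \<Rightarrow> real) set \<Rightarrow> (real, ('a \<Rightarrow> real) set) module" where
  "L_spectral M S =
     \<lparr>carrier = {A \<in> L1_classes M. spectral_norm M S A < \<infinity>},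
      mult = undefined, one = undefined,
      zero = as_eq M `` {\<lambda>_. 0}, add = class_add M, smult = class_scale M\<rparr>"

lemma as_eqD:
  assumes "(Y, Z) \<in> as_eq M"
  shows "Y \<in> borel_measurable M" "Z \<in> borel_measurable M" "AE \<omega> in M. Y \<omega> = Z \<omega>"
  using assms by (simp_all add: as_eq_def)

lemma equiv_as_eq: "equiv (borel_measurable M) (as_eq M)"
proof (rule equivI)
  show "as_eq M \<subseteq> borel_measurable M \<times> borel_measurable M"
    unfolding as_eq_def by blast
  show "refl_on (borel_measurable M) (as_eq M)"
    by (simp add: refl_on_def as_eq_def)
  show "sym (as_eq M)"
    by (simp add: sym_def as_eq_def eq_commute)
  show "trans (as_eq M)"
  proof (rule transI)
    fix Y Z W :: "'a \<Rightarrow> real"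
    assume YZ: "(Y, Z) \<in> as_eq M" and ZW: "(Z, W) \<in> as_eq M"
    have "AE \<omega> in M. Y \<omega> = W \<omega>"
      using as_eqD(3)[OF YZ] as_eqD(3)[OF ZW] by eventually_elim simp
    then show "(Y, W) \<in> as_eq M"
      using as_eqD(1)[OF YZ] as_eqD(2)[OF ZW] by (simp add: as_eq_def)
  qed
qed

lemma class_add_class:
  assumes "Y \<in> borel_measurable M" "Z \<in> borel_measurable M"
  shows "class_add M (as_eq M `` {Y}) (as_eq M `` {Z}) = as_eq M `` {\<lambda>\<omega>. Y \<omega> + Z \<omega>}"
proof -
  have "congruent2 (as_eq M) (as_eq M) (\<lambda>Y Z. as_eq M `` {\<lambda>\<omega>. Y \<omega> + Z \<omega>})"
  proof (rule congruent2I')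
    fix Y Y' Z Z' :: "'a \<Rightarrow> real"
    assume Y: "(Y, Y') \<in> as_eq M" and Z: "(Z, Z') \<in> as_eq M"
    have "AE \<omega> in M. Y \<omega> + Z \<omega> = Y' \<omega> + Z' \<omega>"
      using as_eqD(3)[OF Y] as_eqD(3)[OF Z] by eventually_elim simp
    then have "((\<lambda>\<omega>. Y \<omega> + Z \<omega>), (\<lambda>\<omega>. Y' \<omega> + Z' \<omega>)) \<in> as_eq M"
      using as_eqD(1,2)[OF Y] as_eqD(1,2)[OF Z] by (simp add: as_eq_def)
    then show "as_eq M `` {\<lambda>\<omega>. Y \<omega> + Z \<omega>} = as_eq M `` {\<lambda>\<omega>. Y' \<omega> + Z' \<omega>}"
      by (rule equiv_class_eq[OF equiv_as_eq])
  qed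
  from UN_equiv_class2[OF equiv_as_eq equiv_as_eq this assms] show ?thesis
    unfolding class_add_def .
qed

lemma class_scale_class:
  assumes "Y \<in> borel_measurable M"
  shows "class_scale M c (as_eq M `` {Y}) = as_eq M `` {\<lambda>\<omega>. c * Y \<omega>}"
proof -
  have "congruent (as_eq M) (\<lambda>Y. as_eq M `` {\<lambda>\<omega>. c * Y \<omega>})"
  proof (rule congruentI)
    fix Y Y' :: "'a \<Rightarrow> real"
    assume Y: "(Y, Y') \<in> as_eq M"
    have "AE \<omega> in M. c * Y \<omega> = c * Y' \<omega>"
      using as_eqD(3)[OF Y] by eventually_elim simp
    then have "((\<lambda>\<omega>. c * Y \<omega>), (\<lambda>\<omega>. c * Y' \<omega>)) \<in> as_eq M"
      using as_eqD(1,2)[OF Y] by (simp add: as_eq_def)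
    then show "as_eq M `` {\<lambda>\<omega>. c * Y \<omega>} = as_eq M `` {\<lambda>\<omega>. c * Y' \<omega>}"
      by (rule equiv_class_eq[OF equiv_as_eq])
  qed
  from UN_equiv_class[OF equiv_as_eq this assms] show ?thesis
    unfolding class_scale_def .
qed

lemma quantile_cong_AE:
  assumes "Y \<in> borel_measurable M" "Z \<in> borel_measurable M" "AE \<omega> in M. Y \<omega> = Z \<omega>"
  shows "quantile M Y = quantile M Z"
proof -
  have "\<P>(\<omega> in M. Y \<omega> \<le> y) = \<P>(\<omega> in M. Z \<omega> \<le> y)" for y
  proof (rule measure_eq_AE)
    show "AE \<omega> in M. \<omega> \<in> {\<omega> \<in> space M. Y \<omega> \<le> y} \<longleftrightarrow> \<omega> \<in> {\<omega> \<in> space M. Z \<omega> \<le> y}"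
      using assms(3) by eventually_elim simp
  qed (use assms(1,2) in measurable)
  then show ?thesis
    by (simp add: quantile_def fun_eq_iff)
qed

lemma spectral_norm_class:
  assumes "Z \<in> borel_measurable M"
  shows "spectral_norm M S (as_eq M `` {Z}) = sup_spectral_risk M S (\<lambda>\<omega>. \<bar>Z \<omega>\<bar>)"
proof -
  have "sup_spectral_risk M S (\<lambda>\<omega>. \<bar>Y \<omega>\<bar>) = sup_spectral_risk M S (\<lambda>\<omega>. \<bar>Z \<omega>\<bar>)"
    if "Y \<in> as_eq M `` {Z}" for Y
  proof -
    have "quantile M (\<lambda>\<omega>. \<bar>Y \<omega>\<bar>) = quantile M (\<lambda>\<omega>. \<bar>Z \<omega>\<bar>)"
    proof (rule quantile_cong_AE)
      have YZ: "(Z, Y) \<in> as_eq M"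
        using that by simp
      show "(\<lambda>\<omega>. \<bar>Y \<omega>\<bar>) \<in> borel_measurable M" "(\<lambda>\<omega>. \<bar>Z \<omega>\<bar>) \<in> borel_measurable M"
        using as_eqD(1,2)[OF YZ] by simp_all
      show "AE \<omega> in M. \<bar>Y \<omega>\<bar> = \<bar>Z \<omega>\<bar>"
        using as_eqD(3)[OF YZ] by eventually_elim simp
    qed
    then show ?thesis
      by (simp add: sup_spectral_risk_def spectral_risk_def)
  qed
  moreover have "Z \<in> as_eq M `` {Z}"
    using assms by (simp add: as_eq_def)
  ultimately have "(\<lambda>Y. sup_spectral_risk M S (\<lambda>\<omega>. \<bar>Y \<omega>\<bar>)) ` (as_eq M `` {Z}) =
      {sup_spectral_risk M S (\<lambda>\<omega>. \<bar>Z \<omega>\<bar>)}"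
    by blast
  then show ?thesis
    by (simp add: spectral_norm_def)
qed

end

theory Submission
  imports Defs
begin

text \<open>
  Everything reduces to tail integrals of quantile functions. By the layer cake formula, \<open>\<sigma> u\<close> is the length of \<open>{s. 0 \<le> s < \<sigma> u}\<close>, so that
  \<open>\<rho>\<^sub>\<sigma>(Y) = \<integral>\<^sub>0\<^sup>\<infinity> A(I\<^sub>s, Y) ds\<close>, where \<open>A(I, Y)\<close> is the integral of the quantile
  function of \<open>Y\<close> over \<open>I\<close> and \<open>I\<^sub>s = {u. s < \<sigma> u}\<close>. As \<open>\<sigma>\<close> is
  nondecreasing, \<open>I\<^sub>s\<close> is an upper subset of the unit interval, and for a nonempty upper set
  \<open>I\<close> of length \<open>m\<close> and nonnegative \<open>Y\<close>

    \<open>A(I, Y) = min {c * m + E (Y - c)\<^sup>+ | c \<ge> 0}\<close>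

  (the Rockafellar--Uryasev formula for the average value at risk; lemmas
  \<open>tail_integral_le\<close> and \<open>tail_integral_attained\<close>). The right side no longer
  involves quantiles, and three properties can be read off:
  \<open>A(I, \<cdot>)\<close> is subadditive, \<open>A(I, Y) \<le> E Y\<close>, and \<open>m * E Y \<le> A(I, Y)\<close>.

  Integrating over \<open>s\<close> gives the triangle inequality, and, since the lengths of the
  \<open>I\<^sub>s\<close> integrate to \<open>\<integral> \<sigma> = 1\<close>, the estimate \<open>E \<bar>Y\<bar> \<le> \<parallel>Y\<parallel>\<close>, whence the
  norm is definite. The first two properties show that each \<open>A(I, \<cdot>)\<close> is continuous
  along \<open>L\<^sup>1\<close> convergent sequences; with Fatou's lemma \<open>\<rho>\<^sub>\<sigma>\<close>, and then the supremum
  over \<open>\<sigma>\<close>, is lower semicontinuous in \<open>L\<^sup>1\<close> (\<open>N_le_limit\<close>).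

  Completeness follows: a Cauchy sequence \<open>Y\<^sub>n\<close> is Cauchy in \<open>L\<^sup>1\<close>, hence has an
  \<open>L\<^sup>1\<close> limit \<open>Z\<close>, and letting \<open>m\<close> tend to infinity in
  \<open>\<parallel>Y\<^sub>n - Y\<^sub>m\<parallel> \<le> \<epsilon>\<close> gives \<open>\<parallel>Y\<^sub>n - Z\<parallel> \<le> \<epsilon>\<close> by lower semicontinuity.

  The estimates are made in the extended nonnegative reals and hold for all nonnegative
  measurable functions, with both sides possibly infinite.
\<close>

section \<open>Quantile functions\<close>

lemma ennreal_le_add:
  assumes "a \<le> b + c"
  shows "ennreal a \<le> ennreal b + ennreal c"
  by (rule order_trans[OF ennreal_leI[OF assms]])
     (cases "0 \<le> b"; cases "0 \<le> c"; auto simp: ennreal_neg ennreal_plus[symmetric]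
        simp del: ennreal_plus intro!: ennreal_leI)

abbreviation unit_uniform :: "real measure" where
  "unit_uniform \<equiv> restrict_space lborel {0<..<1}"

lemma prob_space_unit_uniform: "prob_space unit_uniform"
  by (auto simp: space_restrict_space emeasure_restrict_space intro!: prob_spaceI)

lemma space_unit_uniform [simp]: "space unit_uniform = {0<..<1}"
  by (simp add: space_restrict_space)

lemma sets_unit_uniform: "sets unit_uniform = sets (restrict_space borel {0<..<1})"
  by (intro sets_restrict_space_cong) simp

lemma mono_on_measurable_unit_uniform:
  fixes f :: "real \<Rightarrow> real"
  assumes "mono_on {0<..<1} f"
  shows "f \<in> borel_measurable unit_uniform"
  using borel_measurable_mono_on_fnc[OF assms]
  by (simp add: measurable_cong_sets[OF sets_unit_uniform refl])

context prob_space
begin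

lemma cdf_distribution_distr:
  assumes "Y \<in> borel_measurable M"
  shows "cdf_distribution (distr M borel Y)"
  using assms by (simp add: cdf_distribution_def real_distribution_distr)

lemma quantile_eq_Inf_cdf:
  assumes "Y \<in> borel_measurable M"
  shows "quantile M Y u = Inf {y. u \<le> cdf (distr M borel Y) y}"
proof -
  have "cdf (distr M borel Y) y = \<P>(\<omega> in M. Y \<omega> \<le> y)" for y
    using assms by (auto simp: cdf_def measure_distr intro!: arg_cong[where f=prob])
  then show ?thesis by (simp add: quantile_def)
qed

text \<open>
  The Galois connection between the quantile function and the distribution function, which
  replaces the infimum in the arguments for nonnegativity and homogeneity.
\<close>

lemma quantile_le_iff:
  assumes "Y \<in> borel_measurable M" "0 < u" "u < 1"
  shows "quantile M Y u \<le> y \<longleftrightarrow> u \<le> \<P>(\<omega> in M. Y \<omega> \<le> y)"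
proof -
  interpret D: cdf_distribution "distr M borel Y"
    by (rule cdf_distribution_distr) fact
  have "cdf (distr M borel Y) y = \<P>(\<omega> in M. Y \<omega> \<le> y)"
    using assms by (auto simp: cdf_def measure_distr intro!: arg_cong[where f=prob])
  then show ?thesis
    using D.pseudoinverse[OF assms(2,3), of y] by (simp add: quantile_eq_Inf_cdf assms)
qed

lemma mono_on_quantile:
  assumes "Y \<in> borel_measurable M"
  shows "mono_on {0<..<1} (quantile M Y)"
proof -
  interpret D: cdf_distribution "distr M borel Y"
    by (rule cdf_distribution_distr) fact
  show ?thesis
    using D.mono_I by (simp add: quantile_eq_Inf_cdf[OF assms] mono_on_def)
qed

lemma measurable_quantile:
  assumes "Y \<in> borel_measurable M"
  shows "quantile M Y \<in> borel_measurable unit_uniform"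
  by (intro mono_on_measurable_unit_uniform mono_on_quantile assms)

text \<open>
  Under the uniform distribution the quantile function of \<open>Y\<close> has the law of
  \<open>Y\<close>: this is the inverse transform step in the proof of Skorohod's theorem.
\<close>

lemma nn_integral_quantile:
  assumes Y: "Y \<in> borel_measurable M" and f: "f \<in> borel_measurable borel"
  shows "(\<integral>\<^sup>+u. f (quantile M Y u) \<partial>unit_uniform) = (\<integral>\<^sup>+\<omega>. f (Y \<omega>) \<partial>M)"
proof -
  interpret D: cdf_distribution "distr M borel Y"
    by (rule cdf_distribution_distr) fact
  have "(\<integral>\<^sup>+\<omega>. f (Y \<omega>) \<partial>M) = (\<integral>\<^sup>+x. f x \<partial>distr M borel Y)"
    using Y f by (simp add: nn_integral_distr)
  also have "distr M borel Y = distr unit_uniform borel (quantile M Y)"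
    using D.distr_I_eq_M by (simp add: quantile_eq_Inf_cdf[OF Y, abs_def])
  also have "(\<integral>\<^sup>+x. f x \<partial>\<dots>) = (\<integral>\<^sup>+u. f (quantile M Y u) \<partial>unit_uniform)"
    using f measurable_quantile[OF Y] by (simp add: nn_integral_distr)
  finally show ?thesis by simp
qed

text \<open>
  Needs \<open>0 < u\<close>: no level below 0 has positive probability of bounding
  \<open>Y\<close>, but at \<open>u = 0\<close> every level qualifies.
\<close>

lemma quantile_nonneg:
  assumes "Y \<in> borel_measurable M" "\<And>\<omega>. 0 \<le> Y \<omega>" "0 < u" "u < 1"
  shows "0 \<le> quantile M Y u"
proof (rule ccontr)
  assume "\<not> 0 \<le> quantile M Y u"
  moreover have "Y \<omega> \<le> quantile M Y u \<longleftrightarrow> False" if "quantile M Y u < 0" for \<omega>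
    using assms(2)[of \<omega>] that by simp
  ultimately show False
    using quantile_le_iff[OF assms(1,3,4), of "quantile M Y u"] assms(3) by simp
qed

lemma quantile_scale:
  assumes Y: "Y \<in> borel_measurable M" and c: "0 \<le> c" and u: "0 < u" "u < 1"
  shows "quantile M (\<lambda>\<omega>. c * Y \<omega>) u = c * quantile M Y u"
proof -
  have cY: "(\<lambda>\<omega>. c * Y \<omega>) \<in> borel_measurable M" using Y by measurable
  have "quantile M (\<lambda>\<omega>. c * Y \<omega>) u \<le> y \<longleftrightarrow> c * quantile M Y u \<le> y" for y
  proof (cases "c = 0")
    case True
    then show ?thesis
      unfolding quantile_le_iff[OF cY u] using u by (cases "0 \<le> y") (simp_all add: prob_space)
  next
    case False
    with c have c: "0 < c" by simp
    have "c * x \<le> y \<longleftrightarrow> x \<le> y / c" for x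
      using c by (simp add: pos_le_divide_eq mult.commute)
    then show ?thesis
      by (simp add: quantile_le_iff[OF cY u] quantile_le_iff[OF Y u])
  qed
  then show ?thesis
    by (meson order.antisym order.refl)
qed

end

section \<open>Tail integrals\<close>

text \<open>
  Upper sets are intervals and hence measurable; carrying measurability along saves that detour.
\<close>

definition upper_set :: "real set \<Rightarrow> bool" where
  "upper_set I \<longleftrightarrow> I \<in> sets unit_uniform \<and> (\<forall>u\<in>I. \<forall>v\<in>{u..<1}. v \<in> I)"

context prob_space
begin

definition tail_integral :: "real set \<Rightarrow> ('a \<Rightarrow> real) \<Rightarrow> ennreal" where
  "tail_integral I Y = (\<integral>\<^sup>+u\<in>I. ennreal (quantile M Y u) \<partial>unit_uniform)"

text \<open>
  Holds pointwise under the integral, by \<open>q \<le> c + (q - c)\<^sup>+\<close> on \<open>I\<close>.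
  The coercion \<open>ennreal\<close> truncates negative reals, so \<open>ennreal (Y \<omega> - c)\<close> is the
  positive part.
\<close>

lemma tail_integral_le:
  assumes Y[measurable]: "Y \<in> borel_measurable M" and I: "I \<in> sets unit_uniform" and c: "0 \<le> c"
  shows "tail_integral I Y \<le> ennreal c * emeasure unit_uniform I + (\<integral>\<^sup>+\<omega>. ennreal (Y \<omega> - c) \<partial>M)"
proof -
  note measurable_quantile[OF Y, measurable] I[measurable]
  have "tail_integral I Y \<le>
      (\<integral>\<^sup>+u. ennreal c * indicator I u + ennreal (quantile M Y u - c) \<partial>unit_uniform)"
    unfolding tail_integral_def using c
    by (intro nn_integral_mono) (auto split: split_indicator intro!: ennreal_le_add)
  also have "\<dots> = ennreal c * emeasure unit_uniform I
      + (\<integral>\<^sup>+u. ennreal (quantile M Y u - c) \<partial>unit_uniform)"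
    by (simp add: nn_integral_add nn_integral_cmult)
  also have "(\<integral>\<^sup>+u. ennreal (quantile M Y u - c) \<partial>unit_uniform) = (\<integral>\<^sup>+\<omega>. ennreal (Y \<omega> - c) \<partial>M)"
    by (rule nn_integral_quantile[OF Y, where f="\<lambda>x. ennreal (x - c)"]) simp
  finally show ?thesis .
qed

text \<open>
  The minimiser is the infimum \<open>c\<close> of the quantile function \<open>q\<close> on
  \<open>I\<close>: by monotonicity \<open>q \<ge> c\<close> on \<open>I\<close> and \<open>q \<le> c\<close> off
  \<open>I\<close>, so the pointwise inequality behind the upper bound becomes an equality. For empty
  \<open>I\<close> the value 0 need not be attained: \<open>E (Y - c)\<^sup>+\<close> is positive for every
  \<open>c\<close> if \<open>Y\<close> is essentially unbounded.
\<close>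

lemma tail_integral_attained:
  assumes Y[measurable]: "Y \<in> borel_measurable M" and nonneg: "\<And>\<omega>. 0 \<le> Y \<omega>"
    and I: "upper_set I" and ne: "I \<noteq> {}"
  obtains c where "0 \<le> c"
    "tail_integral I Y = ennreal c * emeasure unit_uniform I + (\<integral>\<^sup>+\<omega>. ennreal (Y \<omega> - c) \<partial>M)"
proof -
  note measurable_quantile[OF Y, measurable]
  have Im[measurable]: "I \<in> sets unit_uniform" using I by (simp add: upper_set_def)
  have sub: "I \<subseteq> {0<..<1}" using sets.sets_into_space[OF Im] by simp
  define c where "c = Inf (quantile M Y ` I)"
  have q0: "0 \<le> quantile M Y u" if "u \<in> I" for u
    using quantile_nonneg[OF Y nonneg, of u] that sub by force
  have c0: "0 \<le> c"
    unfolding c_def using ne q0 by (intro cINF_greatest)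
  have inside: "c \<le> quantile M Y u" if "u \<in> I" for u
    unfolding c_def using that q0 by (intro cINF_lower bdd_belowI2)
  have outside: "quantile M Y u \<le> c" if "u \<in> {0<..<1}" "u \<notin> I" for u
    unfolding c_def
  proof (rule cINF_greatest[OF ne])
    fix v assume v: "v \<in> I"
    with I that have "u \<le> v" unfolding upper_set_def by force
    then show "quantile M Y u \<le> quantile M Y v"
      using v sub that mono_on_quantile[OF Y] by (auto simp: mono_on_def)
  qed
  have "tail_integral I Y =
      (\<integral>\<^sup>+u. ennreal c * indicator I u + ennreal (quantile M Y u - c) \<partial>unit_uniform)"
    unfolding tail_integral_def
  proof (rule nn_integral_cong)
    fix u assume "u \<in> space unit_uniform"
    then show "ennreal (quantile M Y u) * indicator I u =
        ennreal c * indicator I u + ennreal (quantile M Y u - c)"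
      using c0 inside[of u] outside[of u]
      by (auto split: split_indicator simp: ennreal_neg simp flip: ennreal_plus)
  qed
  also have "\<dots> = ennreal c * emeasure unit_uniform I
      + (\<integral>\<^sup>+u. ennreal (quantile M Y u - c) \<partial>unit_uniform)"
    by (simp add: nn_integral_add nn_integral_cmult)
  also have "(\<integral>\<^sup>+u. ennreal (quantile M Y u - c) \<partial>unit_uniform) = (\<integral>\<^sup>+\<omega>. ennreal (Y \<omega> - c) \<partial>M)"
    by (rule nn_integral_quantile[OF Y, where f="\<lambda>x. ennreal (x - c)"]) simp
  finally show thesis using that c0 by blast
qed

lemma tail_integral_le_mean:
  assumes Y: "Y \<in> borel_measurable M" and I: "I \<in> sets unit_uniform"
  shows "tail_integral I Y \<le> (\<integral>\<^sup>+\<omega>. ennreal (Y \<omega>) \<partial>M)"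
  using tail_integral_le[OF Y I, of 0] by simp

text \<open>
  Chebyshev's inequality for the nondecreasing functions \<open>indicator I\<close> and
  \<open>quantile M Y\<close>; here it is \<open>E Y \<le> c + E (Y - c)\<^sup>+\<close> multiplied by the length of
  \<open>I\<close>, which is at most 1.
\<close>

lemma mean_le_tail_integral:
  assumes Y[measurable]: "Y \<in> borel_measurable M" and nonneg: "\<And>\<omega>. 0 \<le> Y \<omega>" and I: "upper_set I"
  shows "emeasure unit_uniform I * (\<integral>\<^sup>+\<omega>. ennreal (Y \<omega>) \<partial>M) \<le> tail_integral I Y"
proof (cases "I = {}")
  case False
  interpret U: prob_space unit_uniform by (rule prob_space_unit_uniform)
  from tail_integral_attained[OF Y nonneg I False] obtain c where c: "0 \<le> c"
    "tail_integral I Y = ennreal c * emeasure unit_uniform I + (\<integral>\<^sup>+\<omega>. ennreal (Y \<omega> - c) \<partial>M)" .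
  have "(\<integral>\<^sup>+\<omega>. ennreal (Y \<omega>) \<partial>M) \<le> (\<integral>\<^sup>+\<omega>. ennreal c + ennreal (Y \<omega> - c) \<partial>M)"
    using c(1) by (intro nn_integral_mono ennreal_le_add) auto
  also have "\<dots> = ennreal c + (\<integral>\<^sup>+\<omega>. ennreal (Y \<omega> - c) \<partial>M)"
    by (simp add: nn_integral_add emeasure_space_1)
  finally have "emeasure unit_uniform I * (\<integral>\<^sup>+\<omega>. ennreal (Y \<omega>) \<partial>M) \<le>
      emeasure unit_uniform I * (ennreal c + (\<integral>\<^sup>+\<omega>. ennreal (Y \<omega> - c) \<partial>M))"
    by (rule mult_left_mono) simp
  also have "\<dots> \<le> ennreal c * emeasure unit_uniform I + 1 * (\<integral>\<^sup>+\<omega>. ennreal (Y \<omega> - c) \<partial>M)"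
    unfolding distrib_left mult.commute[of _ "ennreal c"]
    by (intro add_left_mono mult_right_mono U.emeasure_le_1) simp
  finally show ?thesis by (simp add: c)
qed simp

text \<open>
  If \<open>c\<close> and \<open>d\<close> are optimal for \<open>Y\<close> and \<open>Z\<close>, then
  \<open>c + d\<close> is admissible for \<open>W\<close>. Stating it for \<open>W \<le> Y + Z\<close> instead of the
  sum covers \<open>\<bar>Y + Z\<bar>\<close> and, with \<open>W = (W - Y) + Y\<close>, the continuity estimate.
\<close>

lemma tail_integral_subadditive:
  assumes Y[measurable]: "Y \<in> borel_measurable M" and Y0: "\<And>\<omega>. 0 \<le> Y \<omega>"
    and Z[measurable]: "Z \<in> borel_measurable M" and Z0: "\<And>\<omega>. 0 \<le> Z \<omega>"
    and W: "W \<in> borel_measurable M" and le: "\<And>\<omega>. W \<omega> \<le> Y \<omega> + Z \<omega>"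
    and I: "upper_set I"
  shows "tail_integral I W \<le> tail_integral I Y + tail_integral I Z"
proof (cases "I = {}")
  case True
  then show ?thesis by (simp add: tail_integral_def)
next
  case False
  from tail_integral_attained[OF Y Y0 I False] obtain c where c: "0 \<le> c"
    "tail_integral I Y = ennreal c * emeasure unit_uniform I + (\<integral>\<^sup>+\<omega>. ennreal (Y \<omega> - c) \<partial>M)" .
  from tail_integral_attained[OF Z Z0 I False] obtain d where d: "0 \<le> d"
    "tail_integral I Z = ennreal d * emeasure unit_uniform I + (\<integral>\<^sup>+\<omega>. ennreal (Z \<omega> - d) \<partial>M)" .
  have "tail_integral I W \<le>
      ennreal (c + d) * emeasure unit_uniform I + (\<integral>\<^sup>+\<omega>. ennreal (W \<omega> - (c + d)) \<partial>M)"
    using W I c(1) d(1) by (intro tail_integral_le) (auto simp: upper_set_def)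
  also have "(\<integral>\<^sup>+\<omega>. ennreal (W \<omega> - (c + d)) \<partial>M) \<le>
      (\<integral>\<^sup>+\<omega>. ennreal (Y \<omega> - c) + ennreal (Z \<omega> - d) \<partial>M)"
  proof (rule nn_integral_mono)
    fix \<omega>
    show "ennreal (W \<omega> - (c + d)) \<le> ennreal (Y \<omega> - c) + ennreal (Z \<omega> - d)"
      using le[of \<omega>] by (intro ennreal_le_add) simp
  qed
  also have "\<dots> = (\<integral>\<^sup>+\<omega>. ennreal (Y \<omega> - c) \<partial>M) + (\<integral>\<^sup>+\<omega>. ennreal (Z \<omega> - d) \<partial>M)"
    by (rule nn_integral_add) auto
  finally show ?thesis
    using c d by (simp add: algebra_simps)
qed

end

section \<open>Layer cake decomposition of a spectral function\<close>

text \<open>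
  Negative heights are excluded so that the layer cake integral can run over the whole
  line.
\<close>

definition level_set :: "(real \<Rightarrow> real) \<Rightarrow> real \<Rightarrow> real set" where
  "level_set \<sigma> s = {u \<in> {0<..<1}. 0 \<le> s \<and> s < \<sigma> u}"

lemma spectral_function_measurable:
  assumes "spectral_function \<sigma>"
  shows "\<sigma> \<in> borel_measurable unit_uniform"
  using assms by (intro mono_on_measurable_unit_uniform) (auto simp: spectral_function_def mono_on_def)

text \<open>
  Passing from \<open>[0,1)\<close>, where spectral functions live, to \<open>(0,1)\<close>, where quantiles
  are meaningful, only drops a null set.
\<close>

lemma nn_integral_spectral_function:
  assumes "spectral_function \<sigma>"
  shows "(\<integral>\<^sup>+u. ennreal (\<sigma> u) \<partial>unit_uniform) = 1"
proof -
  have int: "integrable lborel (\<lambda>u. indicator {0..<1} u * \<sigma> u)"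
    and one: "(\<integral>u. indicator {0..<1} u * \<sigma> u \<partial>lborel) = 1"
    using assms by (simp_all add: spectral_function_def set_integrable_def set_lebesgue_integral_def)
  have "(\<integral>\<^sup>+u. ennreal (\<sigma> u) \<partial>unit_uniform) =
      (\<integral>\<^sup>+u. ennreal (\<sigma> u) * indicator {0<..<1} u \<partial>lborel)"
    by (rule nn_integral_restrict_space) simp
  also have "\<dots> = (\<integral>\<^sup>+u. ennreal (indicator {0..<1} u * \<sigma> u) \<partial>lborel)"
    using AE_lborel_singleton[of 0]
    by (intro nn_integral_cong_AE, eventually_elim) (auto split: split_indicator)
  also have "\<dots> = ennreal (\<integral>u. indicator {0..<1} u * \<sigma> u \<partial>lborel)"
    using assms
    by (intro nn_integral_eq_integral int AE_I2)
       (auto simp: spectral_function_def split: split_indicator)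
  finally show ?thesis by (simp add: one)
qed

lemma upper_set_level_set:
  assumes "spectral_function \<sigma>"
  shows "upper_set (level_set \<sigma> s)"
proof -
  note spectral_function_measurable[OF assms, measurable]
  have "{u \<in> space unit_uniform. 0 \<le> s \<and> s < \<sigma> u} \<in> sets unit_uniform"
    by measurable
  moreover have "\<sigma> u \<le> \<sigma> v" if "0 < u" "u \<le> v" "v < 1" for u v
    using assms that by (auto simp: spectral_function_def mono_on_def)
  ultimately show ?thesis
    by (auto simp: upper_set_def level_set_def intro: less_le_trans)
qed

text \<open>
  Tonelli's theorem for the region under the graph of \<open>\<sigma>\<close>.
\<close>

lemma layer_cake:
  fixes g :: "real \<Rightarrow> ennreal"
  assumes \<sigma>: "spectral_function \<sigma>" and g[measurable]: "g \<in> borel_measurable unit_uniform"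
  shows "(\<integral>\<^sup>+u. ennreal (\<sigma> u) * g u \<partial>unit_uniform) =
      (\<integral>\<^sup>+s. (\<integral>\<^sup>+u\<in>level_set \<sigma> s. g u \<partial>unit_uniform) \<partial>lborel)" (is "?L = ?R")
    and "(\<lambda>s. \<integral>\<^sup>+u\<in>level_set \<sigma> s. g u \<partial>unit_uniform) \<in> borel_measurable lborel" (is ?meas)
proof -
  note spectral_function_measurable[OF \<sigma>, measurable]
  interpret U: prob_space unit_uniform by (rule prob_space_unit_uniform)
  interpret UL: pair_sigma_finite unit_uniform "lborel :: real measure" ..
  define h where "h u s = (if 0 \<le> s \<and> s < \<sigma> u then g u else 0)" for u s
  have h[measurable]: "(\<lambda>(u, s). h u s) \<in> borel_measurable (unit_uniform \<Otimes>\<^sub>M lborel)"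
    unfolding h_def by measurable
  have h_level: "(\<integral>\<^sup>+u. h u s \<partial>unit_uniform) = (\<integral>\<^sup>+u\<in>level_set \<sigma> s. g u \<partial>unit_uniform)" for s
    by (intro nn_integral_cong) (auto simp: h_def level_set_def split: split_indicator)
  have "(\<integral>\<^sup>+s. h u s \<partial>lborel) = ennreal (\<sigma> u) * g u" if "u \<in> {0<..<1}" for u
  proof -
    have "0 \<le> \<sigma> u" using \<sigma> that by (simp add: spectral_function_def)
    have "(\<integral>\<^sup>+s. h u s \<partial>lborel) = (\<integral>\<^sup>+s. g u * indicator {0..<\<sigma> u} s \<partial>lborel)"
      by (intro nn_integral_cong) (auto simp: h_def split: split_indicator)
    also have "\<dots> = ennreal (\<sigma> u) * g u"
      using \<open>0 \<le> \<sigma> u\<close> by (simp add: nn_integral_cmult mult.commute)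
    finally show ?thesis .
  qed
  then have "?L = (\<integral>\<^sup>+u. \<integral>\<^sup>+s. h u s \<partial>lborel \<partial>unit_uniform)"
    by (intro nn_integral_cong) simp
  also have "\<dots> = (\<integral>\<^sup>+s. \<integral>\<^sup>+u. h u s \<partial>unit_uniform \<partial>lborel)"
    by (rule UL.Fubini'[symmetric]) measurable
  finally show "?L = ?R" by (simp add: h_level)
  have "(\<lambda>s. \<integral>\<^sup>+u. h u s \<partial>unit_uniform) \<in> borel_measurable lborel"
    by measurable
  then show ?meas by (simp add: h_level)
qed

section \<open>Spectral integrals of nonnegative random variables\<close>

lemma le_liminf_if_le_add_null:
  fixes a :: ennreal
  assumes le: "\<And>k. a \<le> b k + d k" and d: "d \<longlonglongrightarrow> 0"
  shows "a \<le> liminf b"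
proof (rule ennreal_le_epsilon)
  fix e :: real assume "0 < e"
  then have "eventually (\<lambda>k. d k < ennreal e) sequentially"
    using order_tendstoD(2)[OF d] by simp
  then have "eventually (\<lambda>k. a \<le> b k + ennreal e) sequentially"
    by eventually_elim (meson le order_trans add_left_mono less_imp_le)
  then have "a \<le> liminf (\<lambda>k. b k + ennreal e)"
    by (rule Liminf_bounded)
  then show "a \<le> liminf b + ennreal e"
    by (simp add: Liminf_add_const)
qed

context prob_space
begin

definition spectral_integral :: "(real \<Rightarrow> real) \<Rightarrow> ('a \<Rightarrow> real) \<Rightarrow> ennreal" where
  "spectral_integral \<sigma> Y = (\<integral>\<^sup>+u. ennreal (\<sigma> u * quantile M Y u) \<partial>unit_uniform)"

lemma spectral_integral_layer_cake:
  assumes \<sigma>: "spectral_function \<sigma>" and Y: "Y \<in> borel_measurable M"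
  shows "spectral_integral \<sigma> Y = (\<integral>\<^sup>+s. tail_integral (level_set \<sigma> s) Y \<partial>lborel)"
    and "(\<lambda>s. tail_integral (level_set \<sigma> s) Y) \<in> borel_measurable lborel"
proof -
  note measurable_quantile[OF Y, measurable]
  have "spectral_integral \<sigma> Y =
      (\<integral>\<^sup>+u. ennreal (\<sigma> u) * ennreal (quantile M Y u) \<partial>unit_uniform)"
    unfolding spectral_integral_def using \<sigma>
    by (intro nn_integral_cong) (simp add: ennreal_mult' spectral_function_def)
  then show "spectral_integral \<sigma> Y = (\<integral>\<^sup>+s. tail_integral (level_set \<sigma> s) Y \<partial>lborel)"
    unfolding tail_integral_def by (subst (asm) layer_cake(1)[OF \<sigma>]) simp_all
  show "(\<lambda>s. tail_integral (level_set \<sigma> s) Y) \<in> borel_measurable lborel"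
    unfolding tail_integral_def by (rule layer_cake(2)[OF \<sigma>]) simp
qed

lemma spectral_integral_subadditive:
  assumes \<sigma>: "spectral_function \<sigma>"
    and Y: "Y \<in> borel_measurable M" and Y0: "\<And>\<omega>. 0 \<le> Y \<omega>"
    and Z: "Z \<in> borel_measurable M" and Z0: "\<And>\<omega>. 0 \<le> Z \<omega>"
    and W: "W \<in> borel_measurable M" and le: "\<And>\<omega>. W \<omega> \<le> Y \<omega> + Z \<omega>"
  shows "spectral_integral \<sigma> W \<le> spectral_integral \<sigma> Y + spectral_integral \<sigma> Z"
proof -
  have "spectral_integral \<sigma> W \<le>
      (\<integral>\<^sup>+s. tail_integral (level_set \<sigma> s) Y + tail_integral (level_set \<sigma> s) Z \<partial>lborel)"
    unfolding spectral_integral_layer_cake(1)[OF \<sigma> W]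
    by (intro nn_integral_mono tail_integral_subadditive Y Y0 Z Z0 W le upper_set_level_set \<sigma>)
  also have "\<dots> = spectral_integral \<sigma> Y + spectral_integral \<sigma> Z"
    unfolding spectral_integral_layer_cake(1)[OF \<sigma> Y] spectral_integral_layer_cake(1)[OF \<sigma> Z]
    by (intro nn_integral_add spectral_integral_layer_cake(2)[OF \<sigma>] Y Z)
  finally show ?thesis .
qed

text \<open>
  The lengths of the level sets integrate to \<open>\<integral> \<sigma> = 1\<close>, so the factors in
  \<open>mean_le_tail_integral\<close> integrate to 1.
\<close>

lemma mean_le_spectral_integral:
  assumes \<sigma>: "spectral_function \<sigma>"
    and Y: "Y \<in> borel_measurable M" and Y0: "\<And>\<omega>. 0 \<le> Y \<omega>"
  shows "(\<integral>\<^sup>+\<omega>. ennreal (Y \<omega>) \<partial>M) \<le> spectral_integral \<sigma> Y"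
proof -
  let ?m = "\<lambda>s. emeasure unit_uniform (level_set \<sigma> s)"
  have sets: "level_set \<sigma> s \<in> sets unit_uniform" for s
    using upper_set_level_set[OF \<sigma>] by (simp add: upper_set_def)
  have m: "(\<integral>\<^sup>+u\<in>level_set \<sigma> s. 1 \<partial>unit_uniform) = ?m s" for s
    by (simp add: sets)
  have "(\<integral>\<^sup>+s. ?m s \<partial>lborel) = (\<integral>\<^sup>+u. ennreal (\<sigma> u) \<partial>unit_uniform)"
    using layer_cake(1)[OF \<sigma>, of "\<lambda>_. 1"] by (simp add: m sets)
  also have "\<dots> = 1"
    by (rule nn_integral_spectral_function[OF \<sigma>])
  finally have "(\<integral>\<^sup>+\<omega>. ennreal (Y \<omega>) \<partial>M) = (\<integral>\<^sup>+s. ?m s \<partial>lborel) * (\<integral>\<^sup>+\<omega>. ennreal (Y \<omega>) \<partial>M)"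
    by simp
  also have "\<dots> = (\<integral>\<^sup>+s. ?m s * (\<integral>\<^sup>+\<omega>. ennreal (Y \<omega>) \<partial>M) \<partial>lborel)"
    using layer_cake(2)[OF \<sigma>, of "\<lambda>_. 1"] by (simp add: nn_integral_multc m sets)
  also have "\<dots> \<le> spectral_integral \<sigma> Y"
    unfolding spectral_integral_layer_cake(1)[OF \<sigma> Y]
    by (intro nn_integral_mono mean_le_tail_integral Y Y0 upper_set_level_set \<sigma>)
  finally show ?thesis .
qed

lemma spectral_integral_scale:
  assumes \<sigma>: "spectral_function \<sigma>" and Y: "Y \<in> borel_measurable M" and c: "0 \<le> c"
  shows "spectral_integral \<sigma> (\<lambda>\<omega>. c * Y \<omega>) = ennreal c * spectral_integral \<sigma> Y"
proof -
  note measurable_quantile[OF Y, measurable] spectral_function_measurable[OF \<sigma>, measurable]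
  have "spectral_integral \<sigma> (\<lambda>\<omega>. c * Y \<omega>) =
      (\<integral>\<^sup>+u. ennreal c * ennreal (\<sigma> u * quantile M Y u) \<partial>unit_uniform)"
    unfolding spectral_integral_def
  proof (rule nn_integral_cong)
    fix u assume "u \<in> space unit_uniform"
    then have "\<sigma> u * quantile M (\<lambda>\<omega>. c * Y \<omega>) u = c * (\<sigma> u * quantile M Y u)"
      by (simp add: quantile_scale[OF Y c])
    then show "ennreal (\<sigma> u * quantile M (\<lambda>\<omega>. c * Y \<omega>) u) =
        ennreal c * ennreal (\<sigma> u * quantile M Y u)"
      by (simp only: ennreal_mult'[OF c])
  qed
  also have "\<dots> = ennreal c * spectral_integral \<sigma> Y"
    unfolding spectral_integral_def by (rule nn_integral_cmult) measurable
  finally show ?thesis .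
qed

text \<open>
  Lower semicontinuity. Subadditivity and \<open>A(I, \<cdot>) \<le> E\<close> bound
  \<open>A(I, Z) - A(I, Y\<^sub>k)\<close> by \<open>E \<bar>Y\<^sub>k - Z\<bar>\<close> for every level set, and Fatou's lemma
  carries this through the layer cake integral. Nothing better than semicontinuity can be
  expected: \<open>\<sigma>\<close> may be unbounded.
\<close>

lemma spectral_integral_le_limit:
  assumes \<sigma>: "spectral_function \<sigma>"
    and Y: "\<And>k. Y k \<in> borel_measurable M" and Y0: "\<And>k \<omega>. 0 \<le> Y k \<omega>"
    and Z: "Z \<in> borel_measurable M"
    and lim: "(\<lambda>k. \<integral>\<^sup>+\<omega>. ennreal \<bar>Y k \<omega> - Z \<omega>\<bar> \<partial>M) \<longlonglongrightarrow> 0"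
    and bound: "\<And>k. spectral_integral \<sigma> (Y k) \<le> e"
  shows "spectral_integral \<sigma> Z \<le> e"
proof -
  have abs_diff: "(\<lambda>\<omega>. \<bar>Y k \<omega> - Z \<omega>\<bar>) \<in> borel_measurable M" for k
    using Y Z by measurable
  have "tail_integral I Z \<le> liminf (\<lambda>k. tail_integral I (Y k))" if I: "upper_set I" for I
  proof -
    have "tail_integral I Z \<le> tail_integral I (Y k) + (\<integral>\<^sup>+\<omega>. ennreal \<bar>Y k \<omega> - Z \<omega>\<bar> \<partial>M)" for k
    proof -
      have "tail_integral I Z \<le> tail_integral I (Y k) + tail_integral I (\<lambda>\<omega>. \<bar>Y k \<omega> - Z \<omega>\<bar>)"
        by (intro tail_integral_subadditive Y Y0 Z abs_diff I) auto
      also have "tail_integral I (\<lambda>\<omega>. \<bar>Y k \<omega> - Z \<omega>\<bar>) \<le> (\<integral>\<^sup>+\<omega>. ennreal \<bar>Y k \<omega> - Z \<omega>\<bar> \<partial>M)"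
        using I by (intro tail_integral_le_mean abs_diff) (simp add: upper_set_def)
      finally show ?thesis by simp
    qed
    then show ?thesis
      by (rule le_liminf_if_le_add_null[OF _ lim])
  qed
  then have "spectral_integral \<sigma> Z \<le>
      (\<integral>\<^sup>+s. liminf (\<lambda>k. tail_integral (level_set \<sigma> s) (Y k)) \<partial>lborel)"
    unfolding spectral_integral_layer_cake(1)[OF \<sigma> Z]
    by (intro nn_integral_mono) (simp add: upper_set_level_set[OF \<sigma>])
  also have "\<dots> \<le> liminf (\<lambda>k. spectral_integral \<sigma> (Y k))"
    unfolding spectral_integral_layer_cake(1)[OF \<sigma> Y]
    by (intro nn_integral_liminf spectral_integral_layer_cake(2)[OF \<sigma> Y])
  also have "\<dots> \<le> e"
    using bound by (intro Liminf_le) simp_all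
  finally show ?thesis .
qed

end

section \<open>Completeness of the space of integrable functions\<close>

text \<open>
  A subsequence with geometrically small steps converges almost everywhere; Fatou's lemma turns
  the Cauchy condition against that subsequence into convergence in mean of the whole sequence.
\<close>

lemma L1_Cauchy_convergent:
  fixes Y :: "nat \<Rightarrow> 'a \<Rightarrow> real"
  assumes int: "\<And>n. integrable M (Y n)"
    and Cauchy: "\<And>e. 0 < e \<Longrightarrow>
      \<exists>N. \<forall>m\<ge>N. \<forall>n\<ge>N. (\<integral>\<^sup>+\<omega>. ennreal \<bar>Y m \<omega> - Y n \<omega>\<bar> \<partial>M) \<le> ennreal e"
  obtains Z where "integrable M Z" "(\<lambda>n. \<integral>\<^sup>+\<omega>. ennreal \<bar>Y n \<omega> - Z \<omega>\<bar> \<partial>M) \<longlonglongrightarrow> 0"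
proof -
  have meas[measurable]: "Y n \<in> borel_measurable M" for n
    using int[of n] by simp
  have "\<exists>N. \<forall>k. \<forall>m\<ge>N k. \<forall>n\<ge>N k.
      (\<integral>\<^sup>+\<omega>. ennreal \<bar>Y m \<omega> - Y n \<omega>\<bar> \<partial>M) \<le> ennreal ((1/2) ^ k)"
    by (intro choice allI Cauchy) simp
  then obtain N where N: "\<And>k m n. N k \<le> m \<Longrightarrow> N k \<le> n \<Longrightarrow>
      (\<integral>\<^sup>+\<omega>. ennreal \<bar>Y m \<omega> - Y n \<omega>\<bar> \<partial>M) \<le> ennreal ((1/2) ^ k)" by blast
  \<comment> \<open>Partial sums make the indices monotone while keeping \<open>r k\<close> above \<open>N k\<close>.\<close>
  define r where "r k = k + (\<Sum>i\<le>k. N i)" for k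
  have r_N: "N k \<le> r k" for k
    unfolding r_def by (rule trans_le_add2) (auto intro: member_le_sum)
  have r_mono: "r k \<le> r (Suc k)" for k
    by (simp add: r_def)
  have r_ge: "k \<le> r k" for k
    by (simp add: r_def)
  define D where "D k \<omega> = Y (r (Suc k)) \<omega> - Y (r k) \<omega>" for k \<omega>
  have D[measurable]: "D k \<in> borel_measurable M" for k
    unfolding D_def by measurable
  have "(\<integral>\<^sup>+\<omega>. (\<Sum>k. ennreal \<bar>D k \<omega>\<bar>) \<partial>M) = (\<Sum>k. \<integral>\<^sup>+\<omega>. ennreal \<bar>D k \<omega>\<bar> \<partial>M)"
    by (rule nn_integral_suminf) measurable
  also have "\<dots> \<le> (\<Sum>k. ennreal ((1/2) ^ k))"
    unfolding D_def
    by (intro suminf_le N summableI) (use r_N r_mono in \<open>blast intro: order_trans\<close>)+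
  also have "\<dots> < \<infinity>"
    by (simp add: suminf_ennreal2 less_top[symmetric])
  finally have "AE \<omega> in M. (\<Sum>k. ennreal \<bar>D k \<omega>\<bar>) \<noteq> \<infinity>"
    by (intro nn_integral_PInf_AE) auto
  then have summable: "AE \<omega> in M. summable (\<lambda>k. D k \<omega>)"
    by eventually_elim (auto intro!: summable_rabs_cancel[OF summable_suminf_not_top])
  define Z where "Z \<omega> = Y (r 0) \<omega> + (\<Sum>k. D k \<omega>)" for \<omega>
  have Z[measurable]: "Z \<in> borel_measurable M"
    unfolding Z_def by measurable
  have lim: "AE \<omega> in M. (\<lambda>k. Y (r k) \<omega>) \<longlonglongrightarrow> Z \<omega>"
    using summable
  proof eventually_elim
    fix \<omega> assume "summable (\<lambda>k. D k \<omega>)"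
    then have "(\<lambda>k. Y (r 0) \<omega> + (\<Sum>i<k. D i \<omega>)) \<longlonglongrightarrow> Z \<omega>"
      unfolding Z_def by (intro tendsto_add tendsto_const summable_LIMSEQ)
    moreover have "(\<Sum>i<k. D i \<omega>) = Y (r k) \<omega> - Y (r 0) \<omega>" for k
      unfolding D_def by (rule sum_lessThan_telescope)
    ultimately show "(\<lambda>k. Y (r k) \<omega>) \<longlonglongrightarrow> Z \<omega>" by simp
  qed
  have bound: "\<exists>N. \<forall>n\<ge>N. (\<integral>\<^sup>+\<omega>. ennreal \<bar>Y n \<omega> - Z \<omega>\<bar> \<partial>M) \<le> ennreal e" if e: "0 < e" for e
  proof -
    from Cauchy[OF e] obtain K where K: "\<And>m n. K \<le> m \<Longrightarrow> K \<le> n \<Longrightarrow>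
      (\<integral>\<^sup>+\<omega>. ennreal \<bar>Y m \<omega> - Y n \<omega>\<bar> \<partial>M) \<le> ennreal e" by blast
    have "(\<integral>\<^sup>+\<omega>. ennreal \<bar>Y n \<omega> - Z \<omega>\<bar> \<partial>M) \<le> ennreal e" if n: "K \<le> n" for n
    proof -
      have "(\<integral>\<^sup>+\<omega>. ennreal \<bar>Y n \<omega> - Z \<omega>\<bar> \<partial>M) =
          (\<integral>\<^sup>+\<omega>. liminf (\<lambda>k. ennreal \<bar>Y n \<omega> - Y (r k) \<omega>\<bar>) \<partial>M)"
        using lim
      proof (intro nn_integral_cong_AE, eventually_elim)
        fix \<omega> assume "(\<lambda>k. Y (r k) \<omega>) \<longlonglongrightarrow> Z \<omega>"
        then have "(\<lambda>k. ennreal \<bar>Y n \<omega> - Y (r k) \<omega>\<bar>) \<longlonglongrightarrow> ennreal \<bar>Y n \<omega> - Z \<omega>\<bar>"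
          by (intro tendsto_ennrealI tendsto_intros)
        then show "ennreal \<bar>Y n \<omega> - Z \<omega>\<bar> = liminf (\<lambda>k. ennreal \<bar>Y n \<omega> - Y (r k) \<omega>\<bar>)"
          by (intro lim_imp_Liminf[symmetric]) auto
      qed
      also have "\<dots> \<le> liminf (\<lambda>k. \<integral>\<^sup>+\<omega>. ennreal \<bar>Y n \<omega> - Y (r k) \<omega>\<bar> \<partial>M)"
        by (intro nn_integral_liminf) measurable
      also have "\<dots> \<le> ennreal e"
      proof (rule Liminf_le)
        show "\<forall>\<^sub>F k in sequentially. (\<integral>\<^sup>+\<omega>. ennreal \<bar>Y n \<omega> - Y (r k) \<omega>\<bar> \<partial>M) \<le> ennreal e"
          using eventually_ge_at_top[of K]
          by eventually_elim (blast intro: K n order_trans[OF _ r_ge])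
      qed simp
      finally show ?thesis .
    qed
    then show ?thesis by blast
  qed
  have "integrable M Z"
  proof -
    from bound[of 1] obtain n where n: "(\<integral>\<^sup>+\<omega>. ennreal \<bar>Y n \<omega> - Z \<omega>\<bar> \<partial>M) \<le> ennreal 1"
      by auto
    then have "integrable M (\<lambda>\<omega>. Y n \<omega> - Z \<omega>)"
      by (intro integrableI_bounded) (auto intro: le_less_trans)
    from Bochner_Integration.integrable_diff[OF int[of n] this] show ?thesis by simp
  qed
  moreover have "(\<lambda>n. \<integral>\<^sup>+\<omega>. ennreal \<bar>Y n \<omega> - Z \<omega>\<bar> \<partial>M) \<longlonglongrightarrow> 0"
  proof (rule order_tendstoI)
    fix a :: ennreal assume "0 < a"
    then obtain e where e: "0 < e" "ennreal e < a"
      by (metis ennreal_cases ennreal_less_zero_iff dense ennreal_less_top order.strict_trans top.not_eq_extremum not_less_iff_gr_or_eq)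
    from bound[OF e(1)] show "\<forall>\<^sub>F n in sequentially. (\<integral>\<^sup>+\<omega>. ennreal \<bar>Y n \<omega> - Z \<omega>\<bar> \<partial>M) < a"
      unfolding eventually_sequentially using e(2) by (meson le_less_trans)
  qed simp
  ultimately show thesis by (rule that)
qed

section \<open>The metric of a normed space on a carrier\<close>

lemma a_inv_eq_smult_minus_one:
  assumes "module (ring_of_type_algebra :: real ring) V" and x: "x \<in> carrier V"
  shows "\<ominus>\<^bsub>V\<^esub> x = (-1) \<odot>\<^bsub>V\<^esub> x"
proof -
  interpret module "ring_of_type_algebra :: real ring" V by fact
  have closed: "a \<odot>\<^bsub>V\<^esub> x \<in> carrier V" for a
    using smult_closed[of a x] x by (simp add: ring_of_type_algebra_def)
  have "(-1) \<odot>\<^bsub>V\<^esub> x \<oplus>\<^bsub>V\<^esub> x = (-1) \<odot>\<^bsub>V\<^esub> x \<oplus>\<^bsub>V\<^esub> 1 \<odot>\<^bsub>V\<^esub> x"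
    using smult_one[OF x] by (simp add: ring_of_type_algebra_def)
  also have "\<dots> = ((-1) + 1) \<odot>\<^bsub>V\<^esub> x"
    using smult_l_distr[of "-1" 1 x] x by (simp add: ring_of_type_algebra_def)
  also have "\<dots> = \<zero>\<^bsub>V\<^esub>"
    using smult_l_null[OF x] by (simp add: ring_of_type_algebra_def)
  finally show ?thesis
    using x closed by (intro minus_equality)
qed

lemma Metric_space_norm_metric:
  assumes V: "normed_vector_space V nrm"
  shows "Metric_space (carrier V) (norm_metric V nrm)"
proof -
  interpret module "ring_of_type_algebra :: real ring" V
    using V by (simp add: normed_vector_space_def)
  have nonneg: "0 \<le> nrm x" and zero: "nrm x = 0 \<longleftrightarrow> x = \<zero>\<^bsub>V\<^esub>"
    and scale: "nrm (a \<odot>\<^bsub>V\<^esub> x) = \<bar>a\<bar> * nrm x" if "x \<in> carrier V" for x a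
    using V that by (auto simp: normed_vector_space_def)
  have triangle: "nrm (x \<oplus>\<^bsub>V\<^esub> y) \<le> nrm x + nrm y" if "x \<in> carrier V" "y \<in> carrier V" for x y
    using V that by (auto simp: normed_vector_space_def)
  have neg: "nrm (\<ominus>\<^bsub>V\<^esub> x) = nrm x" if "x \<in> carrier V" for x
    using scale[OF that, of "-1"] a_inv_eq_smult_minus_one[OF module_axioms that] by simp
  show ?thesis
  proof
    show "0 \<le> norm_metric V nrm x y" for x y
      by (simp add: norm_metric_def nonneg)
    show "norm_metric V nrm x y = norm_metric V nrm y x" for x y
    proof (cases "x \<in> carrier V \<and> y \<in> carrier V")
      case True
      then have "y \<ominus>\<^bsub>V\<^esub> x = \<ominus>\<^bsub>V\<^esub> (x \<ominus>\<^bsub>V\<^esub> y)"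
        by (simp add: a_minus_def minus_add a_comm)
      then show ?thesis using True by (simp add: norm_metric_def neg)
    qed (auto simp: norm_metric_def)
    show "norm_metric V nrm x y = 0 \<longleftrightarrow> x = y" if "x \<in> carrier V" "y \<in> carrier V" for x y
    proof -
      have "x = (x \<ominus>\<^bsub>V\<^esub> y) \<oplus>\<^bsub>V\<^esub> y"
        using that by (simp add: a_minus_def a_assoc l_neg)
      then have "x \<ominus>\<^bsub>V\<^esub> y = \<zero>\<^bsub>V\<^esub> \<longleftrightarrow> x = y"
        using that by (metis l_zero r_neg a_minus_def)
      then show ?thesis
        using that by (simp add: norm_metric_def zero)
    qed
    show "norm_metric V nrm x z \<le> norm_metric V nrm x y + norm_metric V nrm y z"
      if "x \<in> carrier V" "y \<in> carrier V" "z \<in> carrier V" for x y z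
    proof -
      have "x \<ominus>\<^bsub>V\<^esub> z = (x \<ominus>\<^bsub>V\<^esub> y) \<oplus>\<^bsub>V\<^esub> (y \<ominus>\<^bsub>V\<^esub> z)"
        using that by (simp add: a_minus_def a_assoc r_neg1)
      then show ?thesis
        using triangle[of "x \<ominus>\<^bsub>V\<^esub> y" "y \<ominus>\<^bsub>V\<^esub> z"] that by (simp add: norm_metric_def)
    qed
  qed
qed

section \<open>The spectral norm\<close>

context prob_space
begin

definition spectral_seminorm :: "(real \<Rightarrow> real) set \<Rightarrow> ('a \<Rightarrow> real) \<Rightarrow> ennreal" where
  "spectral_seminorm S Y = (SUP \<sigma>\<in>S. spectral_integral \<sigma> (\<lambda>\<omega>. \<bar>Y \<omega>\<bar>))"

text \<open>
  For nonnegative \<open>Y\<close> the negative part in the definition of the risk vanishes, and all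
  that follows can take place in \<open>ennreal\<close>.
\<close>

lemma spectral_risk_eq_spectral_integral:
  assumes \<sigma>: "spectral_function \<sigma>" and Y: "Y \<in> borel_measurable M" and Y0: "\<And>\<omega>. 0 \<le> Y \<omega>"
  shows "spectral_risk M \<sigma> Y = enn2ereal (spectral_integral \<sigma> Y)"
proof -
  have "0 \<le> \<sigma> u * quantile M Y u" if "u \<in> {0<..<1}" for u
    using \<sigma> quantile_nonneg[OF Y Y0, of u] that by (simp add: spectral_function_def)
  then have "(\<integral>\<^sup>+u\<in>{0<..<1}. ennreal (- (\<sigma> u * quantile M Y u)) \<partial>lborel) = (\<integral>\<^sup>+u. 0 \<partial>(lborel :: real measure))"
    by (intro nn_integral_cong) (auto simp: ennreal_neg split: split_indicator)
  then have "(\<integral>\<^sup>+u\<in>{0<..<1}. ennreal (- (\<sigma> u * quantile M Y u)) \<partial>lborel) = 0"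
    by simp
  moreover have "spectral_integral \<sigma> Y = (\<integral>\<^sup>+u\<in>{0<..<1}. ennreal (\<sigma> u * quantile M Y u) \<partial>lborel)"
    unfolding spectral_integral_def by (rule nn_integral_restrict_space) simp
  ultimately show ?thesis by (simp add: spectral_risk_def zero_ennreal.rep_eq)
qed

end

locale spectral_family = prob_space M for M :: "'a measure" +
  fixes S :: "(real \<Rightarrow> real) set"
  assumes nonempty: "S \<noteq> {}"
    and spectral: "\<And>\<sigma>. \<sigma> \<in> S \<Longrightarrow> spectral_function \<sigma>"
begin

abbreviation as_class :: "('a \<Rightarrow> real) \<Rightarrow> ('a \<Rightarrow> real) set" where
  "as_class Y \<equiv> as_eq M `` {Y}"

abbreviation N :: "('a \<Rightarrow> real) \<Rightarrow> ennreal" where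
  "N \<equiv> spectral_seminorm S"

lemma spectral_norm_as_class:
  assumes Y: "Y \<in> borel_measurable M"
  shows "spectral_norm M S (as_class Y) = enn2ereal (N Y)"
proof -
  have abs: "(\<lambda>\<omega>. \<bar>Y \<omega>\<bar>) \<in> borel_measurable M" using Y by measurable
  have "spectral_norm M S (as_class Y) = (SUP \<sigma>\<in>S. enn2ereal (spectral_integral \<sigma> (\<lambda>\<omega>. \<bar>Y \<omega>\<bar>)))"
    unfolding spectral_norm_class[OF Y] sup_spectral_risk_def
    by (intro SUP_cong refl spectral_risk_eq_spectral_integral spectral abs) auto
  also have "\<dots> = sup 0 \<dots>"
    using nonempty by (intro sup_absorb2[symmetric]) (auto intro: SUP_upper2)
  also have "\<dots> = enn2ereal (N Y)"
    unfolding spectral_seminorm_def by (simp add: Sup_ennreal.rep_eq image_image)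
  finally show ?thesis .
qed

lemma mean_le_N:
  assumes Y: "Y \<in> borel_measurable M"
  shows "(\<integral>\<^sup>+\<omega>. ennreal \<bar>Y \<omega>\<bar> \<partial>M) \<le> N Y"
proof -
  obtain \<sigma> where \<sigma>: "\<sigma> \<in> S" using nonempty by blast
  have "(\<integral>\<^sup>+\<omega>. ennreal \<bar>Y \<omega>\<bar> \<partial>M) \<le> spectral_integral \<sigma> (\<lambda>\<omega>. \<bar>Y \<omega>\<bar>)"
    using Y by (intro mean_le_spectral_integral spectral \<sigma>) auto
  also have "\<dots> \<le> N Y"
    unfolding spectral_seminorm_def by (rule SUP_upper[OF \<sigma>])
  finally show ?thesis .
qed

lemma N_triangle:
  assumes Y: "Y \<in> borel_measurable M" and Z: "Z \<in> borel_measurable M"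
  shows "N (\<lambda>\<omega>. Y \<omega> + Z \<omega>) \<le> N Y + N Z"
  unfolding spectral_seminorm_def[of _ "\<lambda>\<omega>. Y \<omega> + Z \<omega>"]
proof (rule SUP_least)
  fix \<sigma> assume \<sigma>: "\<sigma> \<in> S"
  have "spectral_integral \<sigma> (\<lambda>\<omega>. \<bar>Y \<omega> + Z \<omega>\<bar>) \<le>
      spectral_integral \<sigma> (\<lambda>\<omega>. \<bar>Y \<omega>\<bar>) + spectral_integral \<sigma> (\<lambda>\<omega>. \<bar>Z \<omega>\<bar>)"
    using Y Z by (intro spectral_integral_subadditive spectral \<sigma>) auto
  also have "\<dots> \<le> N Y + N Z"
    unfolding spectral_seminorm_def by (intro add_mono SUP_upper \<sigma>)
  finally show "spectral_integral \<sigma> (\<lambda>\<omega>. \<bar>Y \<omega> + Z \<omega>\<bar>) \<le> N Y + N Z" .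
qed

lemma N_scale:
  assumes Y: "Y \<in> borel_measurable M"
  shows "N (\<lambda>\<omega>. c * Y \<omega>) = ennreal \<bar>c\<bar> * N Y"
proof -
  have "N (\<lambda>\<omega>. c * Y \<omega>) = (SUP \<sigma>\<in>S. ennreal \<bar>c\<bar> * spectral_integral \<sigma> (\<lambda>\<omega>. \<bar>Y \<omega>\<bar>))"
    unfolding spectral_seminorm_def abs_mult using Y
    by (intro SUP_cong refl spectral_integral_scale spectral) auto
  then show ?thesis
    by (simp add: spectral_seminorm_def SUP_mult_left_ennreal)
qed

lemma N_zero: "N (\<lambda>_. 0) = 0"
  using N_scale[of "\<lambda>_. 0" 0] by simp

text \<open>
  A supremum of lower semicontinuous functions is lower semicontinuous; taking absolute values
  does not increase the distance in \<open>L\<^sup>1\<close>.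
\<close>

lemma N_le_limit:
  assumes Y: "\<And>k. Y k \<in> borel_measurable M" and Z: "Z \<in> borel_measurable M"
    and lim: "(\<lambda>k. \<integral>\<^sup>+\<omega>. ennreal \<bar>Y k \<omega> - Z \<omega>\<bar> \<partial>M) \<longlonglongrightarrow> 0"
    and bound: "\<And>k. N (Y k) \<le> e"
  shows "N Z \<le> e"
  unfolding spectral_seminorm_def
proof (rule SUP_least)
  fix \<sigma> assume \<sigma>: "\<sigma> \<in> S"
  show "spectral_integral \<sigma> (\<lambda>\<omega>. \<bar>Z \<omega>\<bar>) \<le> e"
  proof (rule spectral_integral_le_limit[where Y="\<lambda>k \<omega>. \<bar>Y k \<omega>\<bar>"])
    show "(\<lambda>k. \<integral>\<^sup>+\<omega>. ennreal \<bar>\<bar>Y k \<omega>\<bar> - \<bar>Z \<omega>\<bar>\<bar> \<partial>M) \<longlonglongrightarrow> 0"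
      by (rule tendsto_sandwich[OF _ _ tendsto_const lim])
         (auto intro!: always_eventually nn_integral_mono ennreal_leI abs_triangle_ineq3)
    show "spectral_integral \<sigma> (\<lambda>\<omega>. \<bar>Y k \<omega>\<bar>) \<le> e" for k
      using SUP_upper[OF \<sigma>, of "\<lambda>\<sigma>. spectral_integral \<sigma> (\<lambda>\<omega>. \<bar>Y k \<omega>\<bar>)"] bound[of k]
      unfolding spectral_seminorm_def by (rule order_trans)
  qed (use Y Z \<sigma> in \<open>auto intro: spectral\<close>)
qed

lemma as_class_eq_iff:
  assumes "Y \<in> borel_measurable M" "Z \<in> borel_measurable M"
  shows "as_class Y = as_class Z \<longleftrightarrow> (AE \<omega> in M. Y \<omega> = Z \<omega>)"
  using eq_equiv_class_iff[OF equiv_as_eq assms] assms by (simp add: as_eq_def)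

text \<open>
  Definiteness up to almost sure equality, from \<open>E \<bar>Y\<bar> \<le> N Y\<close>.
\<close>

lemma N_eq_0_iff:
  assumes Y: "Y \<in> borel_measurable M"
  shows "N Y = 0 \<longleftrightarrow> as_class Y = as_class (\<lambda>_. 0)"
proof
  assume "N Y = 0"
  with mean_le_N[OF Y] have "(\<integral>\<^sup>+\<omega>. ennreal \<bar>Y \<omega>\<bar> \<partial>M) = 0" by simp
  then have "AE \<omega> in M. Y \<omega> = 0"
    using Y by (subst (asm) nn_integral_0_iff_AE) auto
  then show "as_class Y = as_class (\<lambda>_. 0)"
    using Y by (simp add: as_class_eq_iff)
next
  assume "as_class Y = as_class (\<lambda>_. 0)"
  then have "enn2ereal (N Y) = enn2ereal (N (\<lambda>_. 0))"
    using spectral_norm_as_class[OF Y] spectral_norm_as_class[of "\<lambda>_. 0"] by simp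
  then show "N Y = 0" by (simp add: N_zero enn2ereal_inject)
qed

section \<open>The Banach space of classes\<close>

definition finite_norm :: "('a \<Rightarrow> real) set" where
  "finite_norm = {Y. integrable M Y \<and> N Y < \<infinity>}"

lemma finite_normD:
  assumes "Y \<in> finite_norm"
  shows "integrable M Y" "Y \<in> borel_measurable M" "N Y < \<infinity>"
  using assms by (auto simp: finite_norm_def)

lemma finite_norm_zero: "(\<lambda>_. 0) \<in> finite_norm"
  by (simp add: finite_norm_def N_zero)

lemma finite_norm_add:
  assumes Y: "Y \<in> finite_norm" and Z: "Z \<in> finite_norm"
  shows "(\<lambda>\<omega>. Y \<omega> + Z \<omega>) \<in> finite_norm"
proof -
  have "N (\<lambda>\<omega>. Y \<omega> + Z \<omega>) \<le> N Y + N Z"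
    by (intro N_triangle finite_normD Y Z)
  also have "\<dots> < \<infinity>" using finite_normD(3)[OF Y] finite_normD(3)[OF Z] by simp
  finally show ?thesis
    using finite_normD(1)[OF Y] finite_normD(1)[OF Z] by (simp add: finite_norm_def)
qed

lemma finite_norm_scale:
  assumes Y: "Y \<in> finite_norm"
  shows "(\<lambda>\<omega>. c * Y \<omega>) \<in> finite_norm"
  using finite_normD[OF Y] by (simp add: finite_norm_def N_scale ennreal_mult_less_top)

lemma finite_norm_diff:
  assumes "Y \<in> finite_norm" "Z \<in> finite_norm"
  shows "(\<lambda>\<omega>. Y \<omega> - Z \<omega>) \<in> finite_norm"
  using finite_norm_add[OF assms(1) finite_norm_scale[OF assms(2), of "-1"]] by simp

abbreviation V :: "(real, ('a \<Rightarrow> real) set) module" where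
  "V \<equiv> L_spectral M S"

abbreviation nrm :: "('a \<Rightarrow> real) set \<Rightarrow> real" where
  "nrm A \<equiv> real_of_ereal (spectral_norm M S A)"

lemma carrier_V: "carrier V = as_class ` finite_norm"
proof -
  have "spectral_norm M S (as_class Y) < \<infinity> \<longleftrightarrow> N Y < \<infinity>" if "integrable M Y" for Y
    using that by (simp add: spectral_norm_as_class less_top[symmetric])
  then show ?thesis
    by (auto simp: L_spectral_def L1_classes_def quotient_def finite_norm_def)
qed

lemma as_class_in_carrier: "Y \<in> finite_norm \<Longrightarrow> as_class Y \<in> carrier V"
  by (simp add: carrier_V)

lemma add_V:
  assumes "Y \<in> finite_norm" "Z \<in> finite_norm"
  shows "as_class Y \<oplus>\<^bsub>V\<^esub> as_class Z = as_class (\<lambda>\<omega>. Y \<omega> + Z \<omega>)"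
  using assms by (simp add: L_spectral_def class_add_class finite_normD)

lemma smult_V:
  assumes "Y \<in> finite_norm"
  shows "c \<odot>\<^bsub>V\<^esub> as_class Y = as_class (\<lambda>\<omega>. c * Y \<omega>)"
  using assms by (simp add: L_spectral_def class_scale_class finite_normD)

lemma zero_V: "\<zero>\<^bsub>V\<^esub> = as_class (\<lambda>_. 0)"
  by (simp add: L_spectral_def)

lemma nrm_as_class:
  assumes "Y \<in> finite_norm"
  shows "nrm (as_class Y) = enn2real (N Y)"
  unfolding spectral_norm_as_class[OF finite_normD(2)[OF assms]] by (rule enn2real_def[symmetric])

lemma carrier_VE:
  assumes "x \<in> carrier V"
  obtains Y where "Y \<in> finite_norm" "x = as_class Y"
  using assms by (auto simp: carrier_V)

lemmas V_simps =
  as_class_in_carrier add_V smult_V zero_V finite_norm_add finite_norm_scale finite_norm_zero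

lemma module_V: "module (ring_of_type_algebra :: real ring) V"
proof (rule moduleI)
  show "cring (ring_of_type_algebra :: real ring)"
    by (rule cring_from_type_algebra)
  show "abelian_group V"
  proof (rule abelian_groupI)
    show "\<zero>\<^bsub>V\<^esub> \<in> carrier V"
      unfolding zero_V by (rule as_class_in_carrier[OF finite_norm_zero])
  next
    fix x assume "x \<in> carrier V"
    then obtain Y where Y: "Y \<in> finite_norm" "x = as_class Y"
      by (auto simp: carrier_V)
    have "as_class (\<lambda>\<omega>. - 1 * Y \<omega>) \<oplus>\<^bsub>V\<^esub> x = \<zero>\<^bsub>V\<^esub>"
      unfolding Y(2) by (subst add_V) (simp_all add: Y finite_norm_scale[of Y "-1", simplified] zero_V)
    then show "\<exists>y\<in>carrier V. y \<oplus>\<^bsub>V\<^esub> x = \<zero>\<^bsub>V\<^esub>"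
      using as_class_in_carrier[OF finite_norm_scale[OF Y(1), of "-1"]] by blast
  qed (elim carrier_VE; simp add: V_simps ac_simps; fail)+
qed (elim carrier_VE; simp add: V_simps ring_of_type_algebra_def distrib_left distrib_right mult.assoc; fail)+

lemma normed_vector_space_V: "normed_vector_space V nrm"
  unfolding normed_vector_space_def
proof (intro conjI ballI allI module_V)
  fix x assume "x \<in> carrier V"
  then obtain Y where Y: "Y \<in> finite_norm" and x: "x = as_class Y"
    by (auto simp: carrier_V)
  show "0 \<le> nrm x"
    by (simp add: x nrm_as_class[OF Y])
  have "enn2real (N Y) = 0 \<longleftrightarrow> N Y = 0"
    using finite_normD(3)[OF Y] by (auto simp: enn2real_eq_0_iff)
  then show "nrm x = 0 \<longleftrightarrow> x = \<zero>\<^bsub>V\<^esub>"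
    by (simp add: x nrm_as_class[OF Y] zero_V N_eq_0_iff finite_normD(2)[OF Y])
  show "nrm (a \<odot>\<^bsub>V\<^esub> x) = \<bar>a\<bar> * nrm x" for a
    using finite_normD[OF Y]
    by (simp add: x smult_V Y nrm_as_class finite_norm_scale N_scale enn2real_mult)
  fix y assume "y \<in> carrier V"
  then obtain Z where Z: "Z \<in> finite_norm" and y: "y = as_class Z"
    by (auto simp: carrier_V)
  have "enn2real (N (\<lambda>\<omega>. Y \<omega> + Z \<omega>)) \<le> enn2real (N Y + N Z)"
    using finite_normD[OF Y] finite_normD[OF Z] by (intro enn2real_mono N_triangle) auto
  also have "\<dots> = enn2real (N Y) + enn2real (N Z)"
    using finite_normD[OF Y] finite_normD[OF Z] by (intro enn2real_plus) auto
  finally show "nrm (x \<oplus>\<^bsub>V\<^esub> y) \<le> nrm x + nrm y"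
    by (simp add: x y add_V Y Z nrm_as_class finite_norm_add)
qed

lemma norm_metric_V:
  assumes Y: "Y \<in> finite_norm" and Z: "Z \<in> finite_norm"
  shows "norm_metric V nrm (as_class Y) (as_class Z) = enn2real (N (\<lambda>\<omega>. Y \<omega> - Z \<omega>))"
proof -
  have "\<ominus>\<^bsub>V\<^esub> as_class Z = as_class (\<lambda>\<omega>. - 1 * Z \<omega>)"
    using a_inv_eq_smult_minus_one[OF module_V as_class_in_carrier[OF Z]] by (simp add: smult_V Z)
  then have "as_class Y \<ominus>\<^bsub>V\<^esub> as_class Z = as_class (\<lambda>\<omega>. Y \<omega> - Z \<omega>)"
    using add_V[OF Y finite_norm_scale[OF Z, of "-1"]] by (simp add: a_minus_def)
  then show ?thesis
    using Y Z by (simp add: norm_metric_def as_class_in_carrier nrm_as_class finite_norm_diff)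
qed

text \<open>
  The limit is found in \<open>L\<^sup>1\<close>, whose norm the spectral norm dominates; lower semicontinuity of
  the norm upgrades the convergence.
\<close>

lemma mcomplete_V: "Metric_space.mcomplete (carrier V) (norm_metric V nrm)"
proof -
  interpret MS: Metric_space "carrier V" "norm_metric V nrm"
    by (rule Metric_space_norm_metric[OF normed_vector_space_V])
  have "\<exists>x. limitin MS.mtopology f x sequentially" if f: "MS.MCauchy f" for f
  proof -
    have "f n \<in> carrier V" for n
      using f by (auto simp: MS.MCauchy_def)
    then have "\<forall>n. \<exists>Y. Y \<in> finite_norm \<and> f n = as_class Y"
      by (meson carrier_VE)
    then obtain Y where Y: "\<And>n. Y n \<in> finite_norm" and fY: "\<And>n. f n = as_class (Y n)"
      by metis
    note Y_int = finite_normD(1)[OF Y] and Y_meas = finite_normD(2)[OF Y]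
    have Cauchy: "\<exists>K. \<forall>m\<ge>K. \<forall>n\<ge>K. N (\<lambda>\<omega>. Y m \<omega> - Y n \<omega>) \<le> ennreal e" if "0 < e" for e
    proof -
      from f that obtain K where K: "\<And>m n. K \<le> m \<Longrightarrow> K \<le> n \<Longrightarrow> norm_metric V nrm (f m) (f n) < e"
        unfolding MS.MCauchy_def by blast
      have "N (\<lambda>\<omega>. Y m \<omega> - Y n \<omega>) \<le> ennreal e" if "K \<le> m" "K \<le> n" for m n
      proof -
        have "enn2real (N (\<lambda>\<omega>. Y m \<omega> - Y n \<omega>)) \<le> e"
          using K[OF that] by (simp add: fY norm_metric_V Y)
        then have "ennreal (enn2real (N (\<lambda>\<omega>. Y m \<omega> - Y n \<omega>))) \<le> ennreal e"
          by (rule ennreal_leI)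
        then show ?thesis
          using finite_normD(3)[OF finite_norm_diff[OF Y Y]] by simp
      qed
      then show ?thesis by blast
    qed
    have mean_le: "(\<integral>\<^sup>+\<omega>. ennreal \<bar>Y m \<omega> - Y n \<omega>\<bar> \<partial>M) \<le> N (\<lambda>\<omega>. Y m \<omega> - Y n \<omega>)" for m n
      by (intro mean_le_N borel_measurable_diff Y_meas)
    have L1_Cauchy: "\<exists>K. \<forall>m\<ge>K. \<forall>n\<ge>K. (\<integral>\<^sup>+\<omega>. ennreal \<bar>Y m \<omega> - Y n \<omega>\<bar> \<partial>M) \<le> ennreal e"
      if "0 < e" for e
      using Cauchy[OF that] order_trans[OF mean_le] by blast
    obtain Z where Z_int: "integrable M Z"
      and Z_lim: "(\<lambda>n. \<integral>\<^sup>+\<omega>. ennreal \<bar>Y n \<omega> - Z \<omega>\<bar> \<partial>M) \<longlonglongrightarrow> 0"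
      by (rule L1_Cauchy_convergent[OF Y_int L1_Cauchy])
    have Z_meas: "Z \<in> borel_measurable M" using Z_int by simp
    have close: "\<exists>K. \<forall>n\<ge>K. N (\<lambda>\<omega>. Y n \<omega> - Z \<omega>) \<le> ennreal e" if e: "0 < e" for e
    proof -
      from Cauchy[OF e] obtain K where
        K: "\<And>m n. K \<le> m \<Longrightarrow> K \<le> n \<Longrightarrow> N (\<lambda>\<omega>. Y m \<omega> - Y n \<omega>) \<le> ennreal e" by blast
      have "N (\<lambda>\<omega>. Y n \<omega> - Z \<omega>) \<le> ennreal e" if n: "K \<le> n" for n
      \<comment> \<open>The shift by \<open>K\<close> makes the Cauchy bound hold for every \<open>k\<close>.\<close>
      proof (rule N_le_limit[where Y="\<lambda>k \<omega>. Y n \<omega> - Y (k + K) \<omega>"])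
        show "(\<lambda>k. \<integral>\<^sup>+\<omega>. ennreal \<bar>(Y n \<omega> - Y (k + K) \<omega>) - (Y n \<omega> - Z \<omega>)\<bar> \<partial>M) \<longlonglongrightarrow> 0"
          using LIMSEQ_ignore_initial_segment[OF Z_lim, of K] by (simp add: abs_minus_commute)
      qed (use Y_meas Z_meas K n in auto)
      then show ?thesis by blast
    qed
    have "Z \<in> finite_norm"
    proof -
      from close[of 1] obtain n where "N (\<lambda>\<omega>. Y n \<omega> - Z \<omega>) \<le> ennreal 1" by auto
      then have "(\<lambda>\<omega>. Y n \<omega> - Z \<omega>) \<in> finite_norm"
        using Y_int[of n] Z_int by (auto simp: finite_norm_def intro: le_less_trans)
      from finite_norm_diff[OF Y[of n] this] show ?thesis by simp
    qed
    moreover have "\<exists>K. \<forall>n\<ge>K. f n \<in> carrier V \<and> norm_metric V nrm (f n) (as_class Z) < e"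
      if e: "0 < e" for e
    proof -
      from close[of "e/2"] e obtain K where
        K: "\<And>n. K \<le> n \<Longrightarrow> N (\<lambda>\<omega>. Y n \<omega> - Z \<omega>) \<le> ennreal (e/2)" by auto
      have "norm_metric V nrm (f n) (as_class Z) \<le> e/2" if "K \<le> n" for n
        using e enn2real_mono[OF K[OF that]]
        by (simp add: fY norm_metric_V Y \<open>Z \<in> finite_norm\<close>)
      with e show ?thesis
        by (force simp: fY Y as_class_in_carrier)
    qed
    ultimately have "limitin MS.mtopology f (as_class Z) sequentially"
      by (simp add: MS.limit_metric_sequentially as_class_in_carrier)
    then show ?thesis ..
  qed
  then show ?thesis by (simp add: MS.mcomplete_def)
qed

end

theorem theorem33:
  fixes M :: "'a measure" and S :: "(real \<Rightarrow> real) set"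
  assumes "prob_space M"
    and "S \<noteq> {}"
    and "\<And>\<sigma>. \<sigma> \<in> S \<Longrightarrow> spectral_function \<sigma>"
  shows "banach_space (L_spectral M S) (\<lambda>A. real_of_ereal (spectral_norm M S A))"
proof -
  interpret spectral_family M S
    using assms by (simp add: spectral_family_def spectral_family_axioms_def)
  show ?thesis
    unfolding banach_space_def
    using normed_vector_space_V Metric_space_norm_metric[OF normed_vector_space_V] mcomplete_V
    by blast
qed

end
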